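(* Let $\mathbb{X}$ be a real Banach space with topological dual $\mathbb{X}^*$ and let $f:\mathbb{X}\to\mathbb{R}\cup\{+\infty\}$ be a lower semicontinuous convex function. Suppose that $f$ is continuous at a point $\bar x$ with $f(\bar x)<+\infty$. Then $f^\downarrow(\bar x)>0$ if and only if $\mathbf{0}^*\in\mathrm{int}\,\partial f(\bar x)$.
   Context: The steepest descent rate is $f^\downarrow(\bar x)=\liminf_{x\to\bar x}\frac{f(x)-f(\bar x)}{\|x-\bar x\|}=\sup_{\delta>0}\inf_{0<\|x-\bar x\|\le\delta}\frac{f(x)-f(\bar x)}{\|x-\bar x\|}$ (with $\inf\varnothing=+\infty$). $\partial f(\bar x)=\{x^*\in\mathbb{X}^*:\ f(x)-f(\bar x)\ge\langle x^*,x-\bar x\rangle\ \forall x\in\mathbb{X}\}$ is the subdifferential of convex analysis, $\mathbf{0}^*$ is the null vector of $\mathbb{X}^*$, and the interior is with respect to the dual norm on $\mathbb{X}^*$. *)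

theory Defs
  imports "HOL-Analysis.Analysis"
begin

text \<open>
  Functions with values in the reals extended by plus infinity are rendered as functions into
  \<^typ>\<open>ereal\<close> that never take the value minus infinity. The topological dual of \<^typ>\<open>'a\<close> is
  the type of bounded linear maps from \<^typ>\<open>'a\<close> to \<^typ>\<open>real\<close>, whose norm is the dual
  (operator) norm.
\<close>

definition lower_semicontinuous :: "('a::topological_space \<Rightarrow> ereal) \<Rightarrow> bool" where
  "lower_semicontinuous f \<longleftrightarrow> (\<forall>x. f x \<le> Liminf (at x) f)"

text \<open>
  The library's \<^const>\<open>convex_on\<close> covers only real-valued functions. Since zero times infinity
  is zero in \<^typ>\<open>ereal\<close>, allowing the weights zero and one is harmless.
\<close>

definition ereal_convex :: "('a::real_vector \<Rightarrow> ereal) \<Rightarrow> bool" where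
  "ereal_convex f \<longleftrightarrow>
     (\<forall>x y. \<forall>u\<ge>0. \<forall>v\<ge>0. u + v = 1 \<longrightarrow>
        f (u *\<^sub>R x + v *\<^sub>R y) \<le> ereal u * f x + ereal v * f y)"

definition steepest_descent_rate :: "('a::real_normed_vector \<Rightarrow> ereal) \<Rightarrow> 'a \<Rightarrow> ereal" where
  "steepest_descent_rate f xbar = Liminf (at xbar) (\<lambda>x. (f x - f xbar) / ereal (norm (x - xbar)))"

text \<open>
  In a trivial space the infimum below is over the empty set, hence plus infinity.
\<close>

lemma steepest_descent_rate_eq_SUP_INF:
  "steepest_descent_rate f xbar =
     (SUP \<delta>\<in>{0<..}. INF x\<in>{x. 0 < norm (x - xbar) \<and> norm (x - xbar) \<le> \<delta>}.
        (f x - f xbar) / ereal (norm (x - xbar)))"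
proof -
  let ?q = "\<lambda>x. (f x - f xbar) / ereal (norm (x - xbar))"
  let ?C = "\<lambda>\<delta>. {x. 0 < norm (x - xbar) \<and> norm (x - xbar) \<le> \<delta>}"
  have L: "steepest_descent_rate f xbar = (SUP e\<in>{0<..}. INF x\<in>(ball xbar e - {xbar}). ?q x)"
    unfolding steepest_descent_rate_def Liminf_at ..
  show ?thesis
    unfolding L
  proof (rule antisym)
    show "(SUP e\<in>{0<..}. INF x\<in>(ball xbar e - {xbar}). ?q x) \<le> (SUP \<delta>\<in>{0<..}. INF x\<in>?C \<delta>. ?q x)"
    proof (rule SUP_least)
      fix e :: real assume e: "e \<in> {0<..}"
      have "(INF x\<in>(ball xbar e - {xbar}). ?q x) \<le> (INF x\<in>?C (e/2). ?q x)"
        using e by (intro INF_superset_mono) (auto simp: dist_norm norm_minus_commute)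
      also have "\<dots> \<le> (SUP \<delta>\<in>{0<..}. INF x\<in>?C \<delta>. ?q x)"
        using e by (intro SUP_upper) auto
      finally show "(INF x\<in>(ball xbar e - {xbar}). ?q x) \<le> (SUP \<delta>\<in>{0<..}. INF x\<in>?C \<delta>. ?q x)" .
    qed
    show "(SUP \<delta>\<in>{0<..}. INF x\<in>?C \<delta>. ?q x) \<le> (SUP e\<in>{0<..}. INF x\<in>(ball xbar e - {xbar}). ?q x)"
      by (intro SUP_mono bexI INF_superset_mono) (auto simp: dist_norm norm_minus_commute)
  qed
qed

text \<open>
  Intended for points where \<^term>\<open>f\<close> is finite: in \<^typ>\<open>ereal\<close> infinity minus infinity is
  infinity, so at a point of value infinity the definition carries no meaning.
\<close>

definition subdifferential ::
    "('a::real_normed_vector \<Rightarrow> ereal) \<Rightarrow> 'a \<Rightarrow> ('a \<Rightarrow>\<^sub>L real) set" where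
  "subdifferential f xbar =
     {xs. \<forall>x. f x - f xbar \<ge> ereal (blinfun_apply xs (x - xbar))}"

end

(*
  Convexity turns f-down(xbar) > 0 into a global bound f x - f xbar >= c * norm (x - xbar)
  with c > 0: every point can be moved along its segment to xbar into the region where the local
  bound holds. By the definition of the dual norm this bound gives ball 0 c \<subseteq> subdifferential f xbar.
  Conversely, if the dual ball of radius e lies in the subdifferential, testing with e times a norming
  functional of x - xbar gives f x - f xbar >= e * norm (x - xbar). Norming functionals come from
  Hahn-Banach, proved here without extending functionals from subspaces: a pointwise minimal
  sublinear functional is linear.
*)
theory Submission
  imports Defs
begin

section \<open>Sublinear functionals and the Hahn-Banach theorem\<close>

definition sublinear :: "('a::real_vector \<Rightarrow> real) \<Rightarrow> bool" where
  "sublinear p \<longleftrightarrow> (\<forall>x y. p (x + y) \<le> p x + p y) \<and> (\<forall>c\<ge>0. \<forall>x. p (c *\<^sub>R x) = c * p x)"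

lemma sublinearI:
  assumes add: "\<And>x y. p (x + y) \<le> p x + p y"
    and scale: "\<And>c x. 0 < c \<Longrightarrow> p (c *\<^sub>R x) \<le> c * p x"
  shows "sublinear p"
  unfolding sublinear_def
proof (intro conjI allI impI)
  show "p (x + y) \<le> p x + p y" for x y
    by (rule add)
next
  fix c :: real and x
  assume "0 \<le> c"
  show "p (c *\<^sub>R x) = c * p x"
  proof (cases "c = 0")
    case True
    \<comment> \<open>The factor 1/2 gives \<open>p 0 \<le> 0\<close>, the factor 2 gives
      \<open>0 \<le> p 0\<close>.\<close>
    have "p 0 = 0"
      using scale[of "1/2" 0] scale[of 2 0] by simp
    with True show ?thesis
      by simp
  next
    case False
    with \<open>0 \<le> c\<close> have c: "0 < c"
      by simp
    then have "p (inverse c *\<^sub>R (c *\<^sub>R x)) \<le> inverse c * p (c *\<^sub>R x)"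
      by (intro scale) simp
    with c have "c * p x \<le> p (c *\<^sub>R x)"
      by (simp add: field_simps)
    with scale[OF c, of x] show ?thesis
      by simp
  qed
qed

lemma sublinear_add: "sublinear p \<Longrightarrow> p (x + y) \<le> p x + p y"
  by (simp add: sublinear_def)

lemma sublinear_scaleR: "sublinear p \<Longrightarrow> 0 \<le> c \<Longrightarrow> p (c *\<^sub>R x) = c * p x"
  by (simp add: sublinear_def)

lemma sublinear_ge_neg:
  assumes "sublinear p"
  shows "- p (- x) \<le> p x"
  using sublinear_add[OF assms, of x "- x"] sublinear_scaleR[OF assms, of 0 0] by simp

lemma sublinear_norm: "sublinear (norm :: 'a::real_normed_vector \<Rightarrow> real)"
  by (simp add: sublinear_def norm_triangle_ineq)

text \<open>Subadditivity does not pass to infima in general, but in a chain the smaller of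
  \<open>p\<close> and \<open>q\<close> is again a member and lies below both, so its own
  subadditivity bounds \<open>?u (x + y)\<close> by \<open>p x + q y\<close>.\<close>

lemma sublinear_INF_chain:
  fixes C :: "('a::real_vector \<Rightarrow> real) set"
  assumes ne: "C \<noteq> {}" and sub: "\<And>p. p \<in> C \<Longrightarrow> sublinear p"
    and chain: "\<And>p q. p \<in> C \<Longrightarrow> q \<in> C \<Longrightarrow> p \<le> q \<or> q \<le> p"
    and bdd: "\<And>x. bdd_below ((\<lambda>p. p x) ` C)"
  shows "sublinear (\<lambda>x. INF p\<in>C. p x)" (is "sublinear ?u")
proof (rule sublinearI)
  fix x y
  have *: "?u (x + y) \<le> p x + q y" if pq: "p \<in> C" "q \<in> C" for p q
  proof -
    obtain r where r: "r \<in> C" "r \<le> p" "r \<le> q"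
      using chain[OF pq] pq by blast
    have "?u (x + y) \<le> r (x + y)"
      by (rule cINF_lower[OF bdd r(1)])
    also have "\<dots> \<le> r x + r y"
      by (rule sublinear_add[OF sub[OF r(1)]])
    also have "\<dots> \<le> p x + q y"
      using r by (intro add_mono) (auto simp: le_fun_def)
    finally show ?thesis .
  qed
  \<comment> \<open>The infimum is taken over \<open>p\<close> with \<open>q\<close> fixed, and then
    over \<open>q\<close>.\<close>
  have "?u (x + y) - q y \<le> ?u x" if "q \<in> C" for q
    using * that by (intro cINF_greatest ne) (simp add: diff_le_eq)
  then have "?u (x + y) - ?u x \<le> ?u y"
    by (intro cINF_greatest ne) (simp add: diff_le_eq le_diff_eq add.commute)
  then show "?u (x + y) \<le> ?u x + ?u y"
    by simp
next
  fix c :: real and x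
  assume c: "0 < c"
  have "?u (c *\<^sub>R x) / c \<le> p x" if p: "p \<in> C" for p
    using cINF_lower[OF bdd p, of "c *\<^sub>R x"] sublinear_scaleR[OF sub[OF p], of c x] c
    by (simp add: field_simps)
  then have "?u (c *\<^sub>R x) / c \<le> ?u x"
    by (intro cINF_greatest ne)
  with c show "?u (c *\<^sub>R x) \<le> c * ?u x"
    by (simp add: field_simps)
qed

text \<open>The infimum in the proof is the largest sublinear functional \<open>q \<le> p\<close> with \<open>q (- z) \<le> - p z\<close>.\<close>

lemma sublinear_lower:
  fixes p :: "'a::real_vector \<Rightarrow> real"
  assumes p: "sublinear p"
  obtains q where "sublinear q" "q \<le> p" "q (- z) \<le> - p z"
proof -
  let ?g = "\<lambda>x t. p (x + t *\<^sub>R z) - t * p z"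
  define q where "q x = (INF t\<in>{0..}. ?g x t)" for x
  \<comment> \<open>For \<open>0 \<le> t\<close>, \<open>t * p z = p (t *\<^sub>R z) \<le> p (x + t
    *\<^sub>R z) + p (- x)\<close>, a bound on \<open>?g x t\<close> uniform in
    \<open>t\<close>.\<close>
  have bdd: "bdd_below (?g x ` {0..})" for x
  proof (rule bdd_belowI2)
    fix t :: real
    assume "t \<in> {0..}"
    then show "- p (- x) \<le> ?g x t"
      using sublinear_add[OF p, of "x + t *\<^sub>R z" "- x"] sublinear_scaleR[OF p, of t z] by simp
  qed
  have le: "q x \<le> ?g x t" if "0 \<le> t" for x t
    unfolding q_def using that by (intro cINF_lower bdd) simp
  have ge: "m \<le> q x" if "\<And>t. 0 \<le> t \<Longrightarrow> m \<le> ?g x t" for m x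
    unfolding q_def using that by (intro cINF_greatest) auto
  have "sublinear q"
  proof (rule sublinearI)
    fix x y
    have *: "q (x + y) \<le> ?g x s + ?g y t" if "0 \<le> s" "0 \<le> t" for s t
      using le[of "s + t" "x + y"] that sublinear_add[OF p, of "x + s *\<^sub>R z" "y + t *\<^sub>R z"]
      by (simp add: algebra_simps)
    have "q (x + y) - ?g y t \<le> q x" if "0 \<le> t" for t
      using *[OF _ that] by (intro ge) (simp add: diff_le_eq)
    then have "q (x + y) - q x \<le> q y"
      by (intro ge) (smt (verit))
    then show "q (x + y) \<le> q x + q y"
      by simp
  next
    fix c :: real and x
    assume c: "0 < c"
    have "q (c *\<^sub>R x) / c \<le> q x"
    proof (rule ge)
      fix t :: real
      assume t: "0 \<le> t"
      \<comment> \<open>Scaling the parameter along with the point lets \<open>c\<close> factor out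
        of \<open>?g\<close>.\<close>
      have "q (c *\<^sub>R x) \<le> ?g (c *\<^sub>R x) (c * t)"
        using c t by (intro le) simp
      also have "\<dots> = c * ?g x t"
        using sublinear_scaleR[OF p, of c "x + t *\<^sub>R z"] c by (simp add: algebra_simps)
      finally show "q (c *\<^sub>R x) / c \<le> ?g x t"
        using c by (simp add: pos_divide_le_eq mult.commute)
    qed
    with c show "q (c *\<^sub>R x) \<le> c * q x"
      by (simp add: pos_divide_le_eq mult.commute)
  qed
  moreover have "q \<le> p"
    using le[of 0] by (simp add: le_fun_def)
  moreover have "q (- z) \<le> - p z"
    using le[of 1 "- z"] sublinear_scaleR[OF p, of 0 0] by simp
  ultimately show thesis
    by (rule that)
qed

text \<open>Zorn's lemma with the order reversed. A nonempty chain is bounded by its pointwise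
  infimum, which is finite because \<open>q \<le> p\<close> forces
  \<open>q x \<ge> - q (- x) \<ge> - p (- x)\<close>; the empty chain is bounded by \<open>p\<close>
  itself.\<close>

lemma minimal_sublinear_exists:
  fixes p :: "'a::real_vector \<Rightarrow> real"
  assumes p: "sublinear p"
  obtains m where "sublinear m" "m \<le> p" "\<And>q. sublinear q \<Longrightarrow> q \<le> m \<Longrightarrow> q = m"
proof -
  define A where "A = {q. sublinear q \<and> q \<le> p}"
  have po: "partial_order_on A (relation_of (\<lambda>a b. b \<le> a) A)"
    by (rule partial_order_on_relation_ofI) auto
  have "\<exists>m\<in>A. \<forall>a\<in>A. a \<le> m \<longrightarrow> a = m"
  proof (rule predicate_Zorn[OF po])
    fix C
    assume C: "C \<in> Chains (relation_of (\<lambda>a b. b \<le> a) A)"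
    have CA: "C \<subseteq> A" and chain: "\<And>q r. q \<in> C \<Longrightarrow> r \<in> C \<Longrightarrow> q \<le> r \<or> r \<le> q"
      using C unfolding Chains_def relation_of_def by auto
    show "\<exists>u\<in>A. \<forall>a\<in>C. u \<le> a"
    proof (cases "C = {}")
      case True
      with p show ?thesis
        by (auto simp: A_def)
    next
      case False
      let ?u = "\<lambda>x. INF q\<in>C. q x"
      have bdd: "bdd_below ((\<lambda>q. q x) ` C)" for x
      proof (rule bdd_belowI2)
        fix q
        assume "q \<in> C"
        with CA have "sublinear q" "q (- x) \<le> p (- x)"
          by (auto simp: A_def le_fun_def)
        then show "- p (- x) \<le> q x"
          using sublinear_ge_neg[of q x] by linarith
      qed
      have le: "?u \<le> q" if "q \<in> C" for q
        using that by (auto simp: le_fun_def intro!: cINF_lower bdd)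
      have "sublinear ?u"
        using CA by (intro sublinear_INF_chain False chain bdd) (auto simp: A_def)
      moreover have "?u \<le> p"
      proof -
        obtain q where "q \<in> C"
          using False by blast
        with le[of q] CA show ?thesis
          by (auto simp: A_def intro: order_trans)
      qed
      ultimately show ?thesis
        using le unfolding A_def by blast
    qed
  qed
  then obtain m where m: "m \<in> A" "\<And>a. a \<in> A \<Longrightarrow> a \<le> m \<Longrightarrow> a = m"
    by blast
  show thesis
  proof (rule that)
    show "sublinear m" "m \<le> p"
      using m(1) by (auto simp: A_def)
    show "q = m" if "sublinear q" "q \<le> m" for q
      using m that by (auto simp: A_def intro: order_trans)
  qed
qed

text \<open>Minimality identifies \<open>m\<close> with the functional from
  \<open>sublinear_lower\<close>, so \<open>m\<close> is odd. Oddness reverses subadditivity and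
  extends homogeneity to negative scalars.\<close>

lemma minimal_sublinear_linear:
  assumes m: "sublinear m" and min: "\<And>q. sublinear q \<Longrightarrow> q \<le> m \<Longrightarrow> q = m"
  shows "linear m"
proof -
  have neg: "m (- z) = - m z" for z
  proof -
    obtain q where "sublinear q" "q \<le> m" "q (- z) \<le> - m z"
      using sublinear_lower[OF m] .
    with min have "m (- z) \<le> - m z"
      by blast
    with sublinear_ge_neg[OF m, of z] show ?thesis
      by linarith
  qed
  show ?thesis
  proof (rule linearI)
    fix x y
    show "m (x + y) = m x + m y"
      \<comment> \<open>The second instance reads
        \<open>m x \<le> m (x + y) + m (- y) = m (x + y) - m y\<close>.\<close>
      using sublinear_add[OF m, of x y] sublinear_add[OF m, of "x + y" "- y"] neg[of y] by simp
  next
    fix c :: real and x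
    show "m (c *\<^sub>R x) = c *\<^sub>R m x"
      using sublinear_scaleR[OF m, of c x] sublinear_scaleR[OF m, of "- c" x] neg[of "c *\<^sub>R x"]
      by (cases "0 \<le> c") auto
  qed
qed

text \<open>Lowering \<open>p\<close> at \<open>- z\<close> before minimizing fixes the value at
  \<open>z\<close>: every functional below \<open>q\<close> inherits the bound \<open>- p z\<close>
  at \<open>- z\<close>, and for a linear one this means \<open>p z \<le> l z\<close>.\<close>

theorem Hahn_Banach_sublinear:
  fixes p :: "'a::real_vector \<Rightarrow> real"
  assumes p: "sublinear p"
  obtains l where "linear l" "l \<le> p" "l z = p z"
proof -
  obtain q where q: "sublinear q" "q \<le> p" "q (- z) \<le> - p z"
    using sublinear_lower[OF p] .
  obtain l where l: "sublinear l" "l \<le> q" "\<And>r. sublinear r \<Longrightarrow> r \<le> l \<Longrightarrow> r = l"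
    using minimal_sublinear_exists[OF q(1)] by blast
  have lin: "linear l"
    using minimal_sublinear_linear[OF l(1) l(3)] .
  have lp: "l \<le> p"
    using l(2) q(2) by (rule order_trans)
  have "l (- z) \<le> - p z"
    using l(2) q(3) by (auto simp: le_fun_def intro: order_trans)
  then have "p z \<le> l z"
    using linear_neg[OF lin, of z] by simp
  moreover have "l z \<le> p z"
    using lp by (simp add: le_fun_def)
  ultimately have "l z = p z"
    by simp
  with lin lp show thesis
    by (rule that)
qed

text \<open>Domination by the norm at both \<open>x\<close> and \<open>- x\<close> bounds the
  absolute value of \<open>l x\<close>. Asking only for \<open>norm l \<le> 1\<close> also covers
  the trivial space.\<close>

lemma norming_functional_exists:
  fixes z :: "'a::real_normed_vector"
  obtains l :: "'a \<Rightarrow>\<^sub>L real" where "norm l \<le> 1" "blinfun_apply l z = norm z"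
proof -
  obtain l where l: "linear l" "l \<le> norm" "l z = norm z"
    using Hahn_Banach_sublinear[OF sublinear_norm] .
  have bound: "norm (l x) \<le> norm x" for x
    using l(2) linear_neg[OF l(1), of x]
    by (auto simp: le_fun_def abs_le_iff dest: spec[of _ x] spec[of _ "- x"])
  then have bl: "bounded_linear l"
    using l(1) by (intro bounded_linear_intro[of l 1]) (auto simp: linear_add linear_scale)
  show thesis
  proof (rule that)
    show "norm (Blinfun l) \<le> 1"
      using bound by (intro norm_blinfun_bound) (auto simp: bounded_linear_Blinfun_apply[OF bl])
    show "blinfun_apply (Blinfun l) z = norm z"
      by (simp add: bounded_linear_Blinfun_apply[OF bl] l(3))
  qed
qed

section \<open>Linear growth at a point\<close>

lemma steepest_descent_rate_ge:
  assumes "\<And>x. ereal (e * norm (x - xbar)) \<le> f x - f xbar"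
  shows "ereal e \<le> steepest_descent_rate f xbar"
  unfolding steepest_descent_rate_def
proof (rule Liminf_bounded)
  show "\<forall>\<^sub>F x in at xbar. ereal e \<le> (f x - f xbar) / ereal (norm (x - xbar))"
    using assms by (auto simp: eventually_at_filter ereal_le_divide_pos mult.commute)
qed

text \<open>By convexity the difference quotient at a point \<open>y\<close> of the segment from
  \<open>xbar\<close> to \<open>x\<close> is at most the one at \<open>x\<close>, so a lower bound
  near \<open>xbar\<close> holds everywhere.\<close>

lemma linear_growth_of_steepest_descent_rate_pos:
  fixes f :: "'a::real_normed_vector \<Rightarrow> ereal"
  assumes conv: "ereal_convex f" and notm: "\<And>x. f x \<noteq> -\<infinity>" and fin: "f xbar < \<infinity>"
    and pos: "0 < steepest_descent_rate f xbar"
  obtains c where "0 < c" "\<And>x. ereal (c * norm (x - xbar)) \<le> f x - f xbar"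
proof -
  \<comment> \<open>A real \<open>c\<close> strictly below the rate exists even when the rate is
    infinite.\<close>
  obtain c where c: "0 < ereal c" "ereal c < steepest_descent_rate f xbar"
    using ereal_dense2[OF pos] by blast
  have "\<forall>\<^sub>F x in at xbar. ereal c < (f x - f xbar) / ereal (norm (x - xbar))"
    using c(2) unfolding steepest_descent_rate_def by (rule less_LiminfD)
  then obtain d where d: "0 < d"
    and near: "\<And>x. x \<noteq> xbar \<Longrightarrow> dist x xbar < d \<Longrightarrow>
      ereal c < (f x - f xbar) / ereal (norm (x - xbar))"
    unfolding eventually_at by blast
  obtain b where b: "f xbar = ereal b"
    using fin notm[of xbar] by (cases "f xbar") auto
  have "ereal (c * norm (x - xbar)) \<le> f x - f xbar" for x
  proof (cases "x = xbar \<or> f x = \<infinity>")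
    case True
    with b show ?thesis
      by auto
  next
    case False
    then obtain a where a: "f x = ereal a"
      using notm[of x] by (cases "f x") auto
    let ?n = "norm (x - xbar)"
    have n: "0 < ?n"
      using False by simp
    \<comment> \<open>The second term puts \<open>y\<close> within \<open>d / 2\<close> of
      \<open>xbar\<close>, strictly inside the neighbourhood; the cap 1 keeps \<open>y\<close> on
      the segment.\<close>
    define t where "t = min 1 (d / (2 * ?n))"
    have t: "0 < t" "t \<le> 1" and tn: "t * ?n < d"
    proof -
      show "0 < t" "t \<le> 1"
        using n d by (auto simp: t_def)
      have "t * ?n \<le> d / (2 * ?n) * ?n"
        by (intro mult_right_mono) (auto simp: t_def)
      with n d show "t * ?n < d"
        by simp
    qed
    define y where "y = t *\<^sub>R x + (1 - t) *\<^sub>R xbar"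
    have y: "y - xbar = t *\<^sub>R (x - xbar)"
      by (simp add: y_def algebra_simps)
    then have ny: "norm (y - xbar) = t * ?n"
      using t by simp
    have fy: "f y \<le> ereal (t * a + (1 - t) * b)"
    proof -
      have "f y \<le> ereal t * f x + ereal (1 - t) * f xbar"
        using conv[unfolded ereal_convex_def, rule_format, of t "1 - t" x xbar] t
        by (simp add: y_def)
      then show ?thesis
        by (simp add: a b)
    qed
    then obtain g where g: "f y = ereal g"
      using notm[of y] by (cases "f y") auto
    have "ereal c < (f y - f xbar) / ereal (norm (y - xbar))"
      using ny n t tn by (intro near) (auto simp: dist_norm)
    then have "c * (t * ?n) < g - b"
      using ny n t by (simp add: g b pos_less_divide_eq)
    also have "g - b \<le> t * (a - b)"
      using fy g by (simp add: algebra_simps)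
    finally have "t * (c * ?n) < t * (a - b)"
      by (simp add: algebra_simps)
    with t have "c * ?n < a - b"
      by simp
    then show ?thesis
      by (simp add: a b)
  qed
  with c(1) show thesis
    by (intro that) auto
qed

section \<open>Linear growth and dual balls in the subdifferential\<close>

lemma ball_subset_subdifferential:
  assumes "\<And>x. ereal (c * norm (x - xbar)) \<le> f x - f xbar"
  shows "ball 0 c \<subseteq> subdifferential f xbar"
proof
  fix l :: "'a \<Rightarrow>\<^sub>L real"
  assume "l \<in> ball 0 c"
  then have l: "norm l \<le> c"
    by simp
  have "blinfun_apply l (x - xbar) \<le> c * norm (x - xbar)" for x
  proof -
    have "blinfun_apply l (x - xbar) \<le> norm l * norm (x - xbar)"
      using norm_blinfun[of l "x - xbar"] by simp
    also have "\<dots> \<le> c * norm (x - xbar)"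
      using l by (rule mult_right_mono) simp
    finally show ?thesis .
  qed
  then have "ereal (blinfun_apply l (x - xbar)) \<le> f x - f xbar" for x
    using assms[of x] by (meson ereal_less_eq(3) order_trans)
  then show "l \<in> subdifferential f xbar"
    unfolding subdifferential_def by blast
qed

lemma linear_growth_of_cball_subset_subdifferential:
  assumes e: "0 \<le> e" and sub: "cball 0 e \<subseteq> subdifferential f xbar"
  shows "ereal (e * norm (x - xbar)) \<le> f x - f xbar"
proof -
  obtain l :: "'a \<Rightarrow>\<^sub>L real" where l: "norm l \<le> 1" "blinfun_apply l (x - xbar) = norm (x - xbar)"
    using norming_functional_exists .
  \<comment> \<open>This functional may have norm exactly \<open>e\<close>, so the closed ball is
    what admits it and yields the growth constant \<open>e\<close> without loss.\<close>
  have "e *\<^sub>R l \<in> cball 0 e"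
    using e l(1) by (simp add: mult_left_le)
  with sub have "e *\<^sub>R l \<in> subdifferential f xbar"
    by blast
  then have "ereal (blinfun_apply (e *\<^sub>R l) (x - xbar)) \<le> f x - f xbar"
    unfolding subdifferential_def by blast
  then show ?thesis
    by (simp add: scaleR_blinfun.rep_eq l(2))
qed

theorem theorem2:
  fixes f :: "'a::banach \<Rightarrow> ereal" and xbar :: 'a
  assumes "\<And>x. f x \<noteq> -\<infinity>"
    and "lower_semicontinuous f"
    and "ereal_convex f"
    and "isCont f xbar"
    and "f xbar < \<infinity>"
  shows "steepest_descent_rate f xbar > 0 \<longleftrightarrow> 0 \<in> interior (subdifferential f xbar)"
proof
  assume "steepest_descent_rate f xbar > 0"
  then obtain c where c: "0 < c" "\<And>x. ereal (c * norm (x - xbar)) \<le> f x - f xbar"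
    using linear_growth_of_steepest_descent_rate_pos[OF assms(3,1,5)] by blast
  then show "0 \<in> interior (subdifferential f xbar)"
    using ball_subset_subdifferential[OF c(2)] unfolding mem_interior by blast
next
  assume "0 \<in> interior (subdifferential f xbar)"
  then obtain e where e: "0 < e" "cball 0 e \<subseteq> subdifferential f xbar"
    unfolding mem_interior_cball by blast
  then have "ereal e \<le> steepest_descent_rate f xbar"
    by (intro steepest_descent_rate_ge linear_growth_of_cball_subset_subdifferential) auto
  with e(1) show "steepest_descent_rate f xbar > 0"
    by (metis ereal_less(2) less_le_trans)
qed

end
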